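(* Let $\alpha\ge0$, $\beta\ge0$ and $\lambda,\mu\ge0$ be real numbers such that $\lambda+\mu\ge1$. Let $q_0=2$, $q_1=1$ and $q_k=\dfrac{1}{(k+\alpha)^{\lambda}(k+\beta)^{\mu}}$ for $k\ge2$. Then for every positive integer $n$, $$\frac{q_0}{2}+\sum_{k=1}^n q_k\cos k\theta>0,\qquad 0<\theta<\pi.$$ *)

theory Defs
  imports "HOL-Analysis.Analysis"
begin

end

theory Submission
  imports Defs
begin

text \<open>
  Only two properties of the coefficients matter: on \<open>k \<ge> 2\<close> they decrease, and
  \<open>0 \<le> q k \<le> 1 / k\<close> (this is where \<open>lam + \<mu> \<ge> 1\<close> enters).
  Write \<open>t = \<theta> / 2\<close> and \<open>s = sin t\<close>, so that the first two terms of the sum are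
  \<open>1 + cos \<theta> = 2 (1 - s\<^sup>2)\<close>; the rest must not cancel them.

  Multiplied by \<open>2 s\<close>, the cosines telescope, and summation by parts bounds every block
  \<open>\<Sum>k=p..n. q k * cos (2 k t)\<close> of the sum from below by \<open>- q p * (1 + sin ((2 p - 1) t)) / (2 s)\<close>
  (lemma \<open>cos_sum_block_lower_bound\<close>).

  If \<open>s \<ge> 1/4\<close>, this bound with \<open>p = 2\<close> and \<open>q 2 \<le> 1/2\<close> suffices: since \<open>sin (3 t) = 3 s - 4 s\<^sup>3\<close>,
  what remains is \<open>(1 - s) (4 s\<^sup>2 + 4 s - 1) / (4 s) > 0\<close>. The estimate is tight as \<open>\<theta>\<close>
  tends to \<open>\<pi>\<close>, where the first two terms themselves tend to \<open>0\<close> (lemma \<open>cos_sum_positive_away_from_zero\<close>).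

  If \<open>s < 1/4\<close>, the terms with \<open>k \<theta> < \<pi>/2\<close> are nonnegative and are dropped. The block that
  remains starts at \<open>p \<ge> \<pi> / (2 \<theta>)\<close>, so \<open>q p \<le> 1 / p\<close> is of order \<open>\<theta>\<close>, which compensates the
  denominator \<open>s\<close>: the block is at least \<open>- 64/45\<close>, while the first two terms exceed \<open>15/8\<close>
  (lemma \<open>cos_sum_positive_near_zero\<close>).
\<close>

lemma two_sin_cos_telescopes:
  fixes t x c :: real
  shows "2 * sin t * (c * cos (2 * x * t)) = c * (sin ((2 * x + 1) * t) - sin ((2 * x - 1) * t))"
proof -
  have "(2 * x + 1) * t = 2 * x * t + t" and "(2 * x - 1) * t = 2 * x * t - t"
    by (simp_all add: algebra_simps)
  then show ?thesis
    by (simp only: sin_add sin_diff) simp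
qed

text \<open>
  Induction on \<open>n\<close> needs the boundary term at \<open>n\<close> that the plain bound discards. The step works
  because \<open>1 + sin x \<ge> 0\<close> can be multiplied by \<open>q n \<ge> q (n + 1)\<close>.
\<close>

lemma cos_sum_block_summation_by_parts:
  fixes q :: "nat \<Rightarrow> real" and t :: real
  assumes "p \<le> n" and dec: "\<And>k. p \<le> k \<Longrightarrow> q (Suc k) \<le> q k"
  shows "2 * sin t * (\<Sum>k=p..n. q k * cos (2 * real k * t))
           \<ge> q n * (1 + sin ((2 * real n + 1) * t)) - q p * (1 + sin ((2 * real p - 1) * t))"
  using \<open>p \<le> n\<close>
proof (induction n rule: dec_induct)
  case base
  show ?case
    using two_sin_cos_telescopes[of t "q p" "real p"] by (simp add: algebra_simps)
next
  case (step n)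
  have new: "2 * sin t * (q (Suc n) * cos (2 * real (Suc n) * t))
      = q (Suc n) * (sin ((2 * real (Suc n) + 1) * t) - sin ((2 * real n + 1) * t))"
    using two_sin_cos_telescopes[of t "q (Suc n)" "real (Suc n)"] by (simp add: add_ac)
  have "q (Suc n) * (1 + sin ((2 * real n + 1) * t)) \<le> q n * (1 + sin ((2 * real n + 1) * t))"
    using dec[OF step.hyps(1)] sin_ge_minus_one[of "(2 * real n + 1) * t"]
    by (intro mult_right_mono) linarith+
  moreover have "2 * sin t * (\<Sum>k=p..Suc n. q k * cos (2 * real k * t))
      = 2 * sin t * (\<Sum>k=p..n. q k * cos (2 * real k * t))
        + 2 * sin t * (q (Suc n) * cos (2 * real (Suc n) * t))"
    using step.hyps(1) by (simp add: distrib_left del: of_nat_Suc)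
  ultimately show ?case
    using step.IH unfolding new by (simp add: right_diff_distrib distrib_left del: of_nat_Suc)
qed

lemma cos_sum_block_lower_bound:
  fixes q :: "nat \<Rightarrow> real" and t :: real
  assumes "p \<le> n" and dec: "\<And>k. p \<le> k \<Longrightarrow> q (Suc k) \<le> q k" and "q n \<ge> 0" and "sin t > 0"
  shows "(\<Sum>k=p..n. q k * cos (2 * real k * t)) \<ge> - (q p * (1 + sin ((2 * real p - 1) * t))) / (2 * sin t)"
proof -
  have "q n * (1 + sin ((2 * real n + 1) * t)) \<ge> 0"
    using \<open>q n \<ge> 0\<close> sin_ge_minus_one[of "(2 * real n + 1) * t"] by (intro mult_nonneg_nonneg) linarith+
  then have "- (q p * (1 + sin ((2 * real p - 1) * t)))
      \<le> 2 * sin t * (\<Sum>k=p..n. q k * cos (2 * real k * t))"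
    using cos_sum_block_summation_by_parts[where q = q and t = t, OF \<open>p \<le> n\<close> dec] by linarith
  then show ?thesis
    using \<open>sin t > 0\<close> by (subst pos_divide_le_eq) (simp_all add: mult.commute)
qed

text \<open>The difference of the two sides has derivative \<open>t sin t \<ge> 0\<close> and vanishes at \<open>0\<close>.\<close>

lemma x_cos_le_sin:
  fixes t :: real
  assumes "0 \<le> t" and "t \<le> pi"
  shows "t * cos t \<le> sin t"
proof -
  have "(\<lambda>x. sin x - x * cos x) 0 \<le> (\<lambda>x. sin x - x * cos x) t"
  proof (rule DERIV_nonneg_imp_nondecreasing[OF \<open>0 \<le> t\<close>])
    fix x assume "0 \<le> x" "x \<le> t"
    moreover have "((\<lambda>x. sin x - x * cos x) has_real_derivative x * sin x) (at x)"
      by (auto intro!: derivative_eq_intros)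
    ultimately show "\<exists>y. ((\<lambda>x. sin x - x * cos x) has_real_derivative y) (at x) \<and> 0 \<le> y"
      using \<open>t \<le> pi\<close> by (intro exI[of _ "x * sin x"]) (simp add: sin_ge_zero)
  qed
  then show ?thesis by simp
qed

lemma sin_three_times:
  fixes t :: real
  shows "sin (3 * t) = 3 * sin t - 4 * sin t ^ 3"
proof -
  have "sin (3 * t) = sin (2 * t + t)"
    by simp
  also have "\<dots> = 2 * sin t * (cos t)\<^sup>2 + (1 - 2 * (sin t)\<^sup>2) * sin t"
    by (simp only: sin_add sin_double cos_double_sin) (simp add: power2_eq_square)
  also have "\<dots> = 3 * sin t - 4 * sin t ^ 3"
    by (simp only: cos_squared_eq) (simp add: power2_eq_square power3_eq_cube algebra_simps)
  finally show ?thesis .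
qed

lemma cos_sum_positive_away_from_zero:
  fixes q :: "nat \<Rightarrow> real" and t :: real
  assumes dec: "\<And>k. 2 \<le> k \<Longrightarrow> q (Suc k) \<le> q k"
    and nonneg: "\<And>k. 2 \<le> k \<Longrightarrow> 0 \<le> q k" and "q 2 \<le> 1 / 2"
    and "1 / 4 \<le> sin t" and "sin t < 1"
  shows "1 + cos (2 * t) + (\<Sum>k=2..n. q k * cos (2 * real k * t)) > 0"
proof (cases "2 \<le> n")
  case False
  have "(sin t)\<^sup>2 < 1"
    using assms(4,5) by (simp add: power_less_one_iff)
  with False show ?thesis by (simp add: cos_double_sin)
next
  case True
  define s where "s = sin t"
  have s: "1 / 4 \<le> s" "s < 1" using assms(4,5) by (simp_all add: s_def)
  have "q 2 * (1 + sin (3 * t)) \<le> 1 / 2 * (1 + sin (3 * t))"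
    using \<open>q 2 \<le> 1 / 2\<close> sin_ge_minus_one[of "3 * t"] by (intro mult_right_mono) linarith+
  then have "- (1 / 2 * (1 + (3 * s - 4 * s ^ 3))) / (2 * s) \<le> - (q 2 * (1 + sin (3 * t))) / (2 * s)"
    using s by (intro divide_right_mono) (simp_all add: sin_three_times s_def)
  also have "\<dots> \<le> (\<Sum>k=2..n. q k * cos (2 * real k * t))"
    using cos_sum_block_lower_bound[where q = q and t = t, OF True dec nonneg[OF True]] s by (simp add: s_def)
  finally have "- (1 / 2 * (1 + (3 * s - 4 * s ^ 3))) / (2 * s)
      \<le> (\<Sum>k=2..n. q k * cos (2 * real k * t))" .
  moreover have "2 - 2 * s\<^sup>2 + - (1 / 2 * (1 + (3 * s - 4 * s ^ 3))) / (2 * s)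
      = (1 - s) * (4 * s\<^sup>2 + 4 * s - 1) / (4 * s)"
    using s by (simp add: field_simps power2_eq_square power3_eq_cube)
  moreover have "(1 - s) * (4 * s\<^sup>2 + 4 * s - 1) / (4 * s) > 0"
  proof -
    have "0 < s\<^sup>2" using s by simp
    then have "0 < 4 * s\<^sup>2 + 4 * s - 1" using s by linarith
    then show ?thesis using s by simp
  qed
  moreover have "1 + cos (2 * t) = 2 - 2 * s\<^sup>2"
    by (simp add: cos_double_sin s_def)
  ultimately show ?thesis by linarith
qed

lemma cos_sum_positive_near_zero:
  fixes q :: "nat \<Rightarrow> real" and t :: real
  assumes dec: "\<And>k. 2 \<le> k \<Longrightarrow> q (Suc k) \<le> q k"
    and nonneg: "\<And>k. 2 \<le> k \<Longrightarrow> 0 \<le> q k"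
    and le: "\<And>k. 2 \<le> k \<Longrightarrow> q k \<le> 1 / real k"
    and t: "0 < t" "t \<le> pi / 2" and small: "sin t < 1 / 4"
  shows "1 + cos (2 * t) + (\<Sum>k=2..n. q k * cos (2 * real k * t)) > 0"
proof -
  define s where "s = sin t"
  have s: "0 < s" "s < 1 / 4"
    using t small by (simp_all add: s_def sin_gt_zero)
  have s2: "s\<^sup>2 \<le> 1 / 16"
    using power_mono[of s "1 / 4" 2] s by (simp add: power2_eq_square)
  have "t < pi / 6"
  proof (rule ccontr)
    assume "\<not> t < pi / 6"
    then have "sin (pi / 6) \<le> sin t"
      using t by (intro sin_monotone_2pi_le) auto
    with small show False by (simp add: sin_30)
  qed
  \<comment> \<open>from \<open>sin x \<le> x\<close> at \<open>x = \<pi> / 6\<close>\<close>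
  have "3 \<le> pi"
    using sin_x_le_x[of "pi / 6"] by (simp add: sin_30)
  have head: "1 + cos (2 * t) \<ge> 15 / 8"
    using s2 by (simp add: cos_double_sin s_def)
  \<comment> \<open>the first \<open>k\<close> whose angle \<open>2 k t\<close> is at least \<open>\<pi> / 2\<close>\<close>
  define p where "p = nat \<lceil>pi / (4 * t)\<rceil>"
  have "pi / (4 * t) > 1"
    using \<open>t < pi / 6\<close> t by (simp add: field_simps)
  then have "2 \<le> p"
    unfolding p_def by linarith
  have p_lower: "pi / (4 * t) \<le> real p"
    unfolding p_def by (rule real_nat_ceiling_ge)
  have head_nonneg: "0 \<le> q k * cos (2 * real k * t)" if "2 \<le> k" "k < p" for k
  proof -
    have "real k < pi / (4 * t)"
      using \<open>k < p\<close> unfolding p_def by linarith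
    then have "2 * real k * t \<le> pi / 2"
      using t by (simp add: field_simps)
    then have "0 \<le> cos (2 * real k * t)"
      using t by (intro cos_ge_zero) (auto intro: order_trans[of _ 0])
    then show ?thesis
      using nonneg[OF \<open>2 \<le> k\<close>] by simp
  qed
  have "(\<Sum>k=2..n. q k * cos (2 * real k * t)) \<ge> - (64 / 45)"
  proof (cases "p \<le> n")
    case False
    then have "(\<Sum>k=2..n. q k * cos (2 * real k * t)) \<ge> 0"
      by (intro sum_nonneg head_nonneg) auto
    then show ?thesis by linarith
  next
    case True
    have "q p \<le> 1 / real p"
      using le[OF \<open>2 \<le> p\<close>] .
    also have "\<dots> \<le> 1 / (pi / (4 * t))"
      using p_lower \<open>pi / (4 * t) > 1\<close> by (intro frac_le) auto
    also have "\<dots> = 4 * t / pi"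
      by simp
    also have "\<dots> \<le> 4 * t / 3"
      using \<open>3 \<le> pi\<close> t by (intro divide_left_mono) auto
    finally have qp: "q p \<le> 4 * t / 3" .
    have "t * (15 / 16) \<le> s"
    proof -
      have "0 \<le> cos t" using t by (intro cos_ge_zero) auto
      then have "(cos t)\<^sup>2 \<le> cos t"
        by (simp add: power2_eq_square mult_left_le)
      then have "15 / 16 \<le> cos t"
        using s2 by (simp add: cos_squared_eq s_def)
      then have "t * (15 / 16) \<le> t * cos t"
        using t by simp
      also have "\<dots> \<le> s"
        unfolding s_def using t by (intro x_cos_le_sin) auto
      finally show ?thesis .
    qed
    with qp have "q p \<le> 64 / 45 * s" by linarith
    have "q p * (1 + sin ((2 * real p - 1) * t)) \<le> q p * 2"
      using nonneg[OF \<open>2 \<le> p\<close>] sin_le_one[of "(2 * real p - 1) * t"]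
      by (intro mult_left_mono) linarith+
    also have "\<dots> \<le> 64 / 45 * (2 * s)"
      using \<open>q p \<le> 64 / 45 * s\<close> by simp
    finally have "- (64 / 45) \<le> - (q p * (1 + sin ((2 * real p - 1) * t))) / (2 * s)"
      using s by (simp add: field_simps)
    also have "\<dots> \<le> (\<Sum>k=p..n. q k * cos (2 * real k * t))"
      unfolding s_def using True \<open>2 \<le> p\<close> s dec nonneg
      by (intro cos_sum_block_lower_bound) (auto simp: s_def)
    finally have "- (64 / 45) \<le> (\<Sum>k=p..n. q k * cos (2 * real k * t))" .
    also have "\<dots> \<le> (\<Sum>k=2..<p. q k * cos (2 * real k * t)) + \<dots>"
      using sum_nonneg[of "{2..<p}" "\<lambda>k. q k * cos (2 * real k * t)"] head_nonneg by auto
    also have "\<dots> = (\<Sum>k=2..n. q k * cos (2 * real k * t))"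
    proof -
      have "{2..n} = {2..<p} \<union> {p..n}"
        using True \<open>2 \<le> p\<close> by auto
      then show ?thesis
        by (simp add: sum.union_disjoint ivl_disj_int)
    qed
    finally show ?thesis .
  qed
  with head show ?thesis by linarith
qed

theorem theorem3p3:
  fixes \<alpha> \<beta> lam \<mu> :: real and q :: "nat \<Rightarrow> real" and n :: nat and \<theta> :: real
  assumes "\<alpha> \<ge> 0" and "\<beta> \<ge> 0" and "lam \<ge> 0" and "\<mu> \<ge> 0"
    and "lam + \<mu> \<ge> 1"
    and "q 0 = 2" and "q 1 = 1"
    and "\<And>k. k \<ge> 2 \<Longrightarrow>
           q k = 1 / ((real k + \<alpha>) powr lam * (real k + \<beta>) powr \<mu>)"
    and "n \<ge> 1"
    and "0 < \<theta>" and "\<theta> < pi"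
  shows "q 0 / 2 + (\<Sum>k=1..n. q k * cos (real k * \<theta>)) > 0"
proof -
  note q = assms(8)
  have nonneg: "0 \<le> q k" if "2 \<le> k" for k
    using q[OF that] by simp
  have dec: "q (Suc k) \<le> q k" if "2 \<le> k" for k
  proof -
    have "(real k + \<alpha>) powr lam * (real k + \<beta>) powr \<mu>
        \<le> (real (Suc k) + \<alpha>) powr lam * (real (Suc k) + \<beta>) powr \<mu>"
      using assms(1-4) by (intro mult_mono powr_mono2) auto
    moreover have "0 < (real k + \<alpha>) powr lam * (real k + \<beta>) powr \<mu>"
      using that assms(1,2) by simp
    ultimately show ?thesis
      using q[of k] q[of "Suc k"] that by (simp add: frac_le del: of_nat_Suc)
  qed
  have le: "q k \<le> 1 / real k" if "2 \<le> k" for k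
  proof -
    have "real k = real k powr 1"
      using that by simp
    also have "\<dots> \<le> real k powr (lam + \<mu>)"
      using that assms(5) by (intro powr_mono) auto
    also have "\<dots> = real k powr lam * real k powr \<mu>"
      by (rule powr_add)
    also have "\<dots> \<le> (real k + \<alpha>) powr lam * (real k + \<beta>) powr \<mu>"
      using assms(1-4) by (intro mult_mono powr_mono2) auto
    finally show ?thesis
      using q[OF that] that by (simp add: frac_le)
  qed
  define t where "t = \<theta> / 2"
  have t: "0 < t" "t < pi / 2" "\<theta> = 2 * t"
    using assms(10,11) by (simp_all add: t_def)
  have "1 + cos (2 * t) + (\<Sum>k=2..n. q k * cos (2 * real k * t)) > 0"
  proof (cases "sin t < 1 / 4")
    case True
    show ?thesis
      by (rule cos_sum_positive_near_zero[where q = q, OF dec nonneg le t(1) _ True]) (use t in auto)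
  next
    case False
    have "sin t < sin (pi / 2)"
      using t by (intro sin_monotone_2pi) auto
    then have "sin t < 1"
      by simp
    moreover have "q 2 \<le> 1 / 2"
      using le[of 2] by simp
    ultimately show ?thesis
      using False by (intro cos_sum_positive_away_from_zero[where q = q, OF dec nonneg]) auto
  qed
  moreover have "(\<Sum>k=1..n. q k * cos (real k * \<theta>))
      = cos (2 * t) + (\<Sum>k=2..n. q k * cos (2 * real k * t))"
    using \<open>n \<ge> 1\<close> \<open>q 1 = 1\<close> t(3)
    by (simp add: sum.atLeast_Suc_atMost numeral_2_eq_2 mult_ac)
  ultimately show ?thesis
    using \<open>q 0 = 2\<close> by simp
qed

end
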